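(* Let $n=3$ and let $\alpha\in[0,1]$. The two-stage facility location game with parameters $n=3$ and $\alpha$ has a $\rho$-approximate pure subgame perfect equilibrium ($\rho$-SPE) with $$\rho=\frac{1-\alpha^2+\sqrt{17+\alpha\,(16+2\alpha+\alpha^3)}}{4-2(\alpha-2)\alpha}.$$
   Context: The game with parameters $n\ge 1$ and $\alpha\in[0,1]$: there are $n$ facility players $\{1,\dots,n\}$, each choosing a location $s_i\in[0,1]$; a facility location vector is $\mathsf{s}=(s_1,\dots,s_n)\in[0,1]^n$, and $(\mathsf{s}_{-i},s_i')$ is $\mathsf{s}$ with $s_i$ replaced by $s_i'$. The clients are the points $z\in[0,1]$. A client mapping is a function $\mathsf{f}:[0,1]^n\times[0,1]\to\{1,\dots,n\}$; client $z$ uses facility $\mathsf{f}(\mathsf{s},z)$. Only measurable mappings are considered: for every $\mathsf{s}$ and $i$, the set $\{z:\mathsf{f}(\mathsf{s},z)=i\}$ is a finite union of disjoint intervals; its total length is the load $\ell_i(\mathsf{s},\mathsf{f})$. The cost of client $z$ is $C_z(\mathsf{s},\mathsf{f})=(1-\alpha)|s_{\mathsf{f}(\mathsf{s},z)}-z|+\alpha\,\ell_{\mathsf{f}(\mathsf{s},z)}(\mathsf{s},\mathsf{f})$. The utility of facility $i$ is $u_i(\mathsf{s},\mathsf{f})=\ell_i(\mathsf{s},\mathsf{f})$. A pair $(\mathsf{s},\mathsf{f})$ is a $\rho$-SPE if (1) for all $i$ and all $s_i'\in[0,1]$, $\rho\cdot u_i(\mathsf{s},\mathsf{f})\ge u_i((\mathsf{s}_{-i},s_i'),\mathsf{f})$;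 and (2) for every location vector $\mathsf{t}\in[0,1]^n$, $\mathsf{f}(\mathsf{t},\cdot)$ is a client equilibrium, i.e. no single client $z$ can decrease her cost by changing only her own choice of facility: for all $z\in[0,1]$ and all $j$, $(1-\alpha)|t_{\mathsf{f}(\mathsf{t},z)}-z|+\alpha\ell_{\mathsf{f}(\mathsf{t},z)}(\mathsf{t},\mathsf{f})\le(1-\alpha)|t_j-z|+\alpha\ell_j(\mathsf{t},\mathsf{f})$. *)

theory Defs
  imports "HOL-Analysis.Analysis"
begin

text \<open>
  The facility players are the elements of a finite type \<open>'n\<close>, so there are \<open>CARD('n)\<close> of them.
  Location vectors are points of \<open>real ^ 'n\<close> in the unit cube. A client mapping is a total function
  on \<open>real ^ 'n\<close> and \<open>real\<close>; every definition below reads it only on the unit cube and the unit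
  interval, so its values elsewhere are irrelevant.
\<close>

definition location_vectors :: "(real ^ 'n) set" where
  "location_vectors = {s. \<forall>i. s $ i \<in> {0..1}}"

definition relocate :: "real ^ 'n \<Rightarrow> 'n \<Rightarrow> real \<Rightarrow> real ^ 'n" where
  "relocate s i x = (\<chi> j. if j = i then x else s $ j)"

type_synonym 'n client_map = "real ^ 'n \<Rightarrow> real \<Rightarrow> 'n"

definition clients_of :: "real ^ 'n \<Rightarrow> 'n client_map \<Rightarrow> 'n \<Rightarrow> real set" where
  "clients_of s f i = {z \<in> {0..1}. f s z = i}"

text \<open>Intervals may be open, closed, half-open, or degenerate to a point.\<close>

definition finite_disjoint_intervals :: "real set \<Rightarrow> bool" where
  "finite_disjoint_intervals A \<longleftrightarrow>
     (\<exists>I. finite I \<and> disjoint I \<and> (\<forall>J\<in>I. is_interval J) \<and> A = \<Union>I)"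

definition measurable_client_map :: "('n::finite) client_map \<Rightarrow> bool" where
  "measurable_client_map f \<longleftrightarrow>
     (\<forall>s\<in>location_vectors. \<forall>i. finite_disjoint_intervals (clients_of s f i))"

text \<open>For a finite union of disjoint intervals, Lebesgue measure is the total length.\<close>

definition load :: "real ^ 'n \<Rightarrow> 'n client_map \<Rightarrow> 'n \<Rightarrow> real" where
  "load s f i = measure lborel (clients_of s f i)"

definition utility :: "real ^ 'n \<Rightarrow> 'n client_map \<Rightarrow> 'n \<Rightarrow> real" where
  "utility s f i = load s f i"

text \<open>
  The cost to client \<open>z\<close> of using facility \<open>j\<close>. A single client has measure zero, so the loads are
  those of \<open>f\<close> even when \<open>j\<close> is not the facility that \<open>f\<close> assigns to \<open>z\<close>.
\<close>

definition cost_at :: "real \<Rightarrow> real ^ 'n \<Rightarrow> 'n client_map \<Rightarrow> real \<Rightarrow> 'n \<Rightarrow> real" where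
  "cost_at \<alpha> s f z j = (1 - \<alpha>) * \<bar>s $ j - z\<bar> + \<alpha> * load s f j"

definition client_cost :: "real \<Rightarrow> real ^ 'n \<Rightarrow> 'n client_map \<Rightarrow> real \<Rightarrow> real" where
  "client_cost \<alpha> s f z = cost_at \<alpha> s f z (f s z)"

definition client_equilibrium :: "real \<Rightarrow> real ^ 'n \<Rightarrow> 'n client_map \<Rightarrow> bool" where
  "client_equilibrium \<alpha> s f \<longleftrightarrow> (\<forall>z\<in>{0..1}. \<forall>j. client_cost \<alpha> s f z \<le> cost_at \<alpha> s f z j)"

definition approx_SPE :: "real \<Rightarrow> real \<Rightarrow> real ^ 'n \<Rightarrow> ('n::finite) client_map \<Rightarrow> bool" where
  "approx_SPE \<alpha> \<rho> s f \<longleftrightarrow>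
     s \<in> location_vectors \<and>
     measurable_client_map f \<and>
     (\<forall>i. \<forall>x\<in>{0..1}. \<rho> * utility s f i \<ge> utility (relocate s i x) f i) \<and>
     (\<forall>t\<in>location_vectors. client_equilibrium \<alpha> t f)"

end

theory Submission
  imports Defs
begin

text \<open>
  Place the facilities at \<open>x\<close>, \<open>1/2\<close>, \<open>1 - x\<close>. Cutting \<open>[0,1]\<close> at points \<open>b \<le> c\<close> at which neighbouring
  facilities are equally expensive, and serving the three pieces in the order of the facilities,
  is always a client equilibrium, and Brouwer's theorem provides such cuts. An outer
  facility gains most by moving towards the middle until the cut is exactly at its own location,
  and the middle facility gains most by moving outside in the same manner. The location
  \<open>x\<close> that equalises the two gain ratios is a root of a quadratic equation in \<open>[1/(4 - \<alpha>), 1/3]\<close>,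
  and the common ratio is \<open>1 + 2 (1 - \<alpha>)\<^sup>2 x / (2 + 2 \<alpha> - \<alpha>\<^sup>2)\<close>.
\<close>

section \<open>Equilibrium cuts: reflection and existence\<close>

text \<open>
  The last two conjuncts follow from the cost equations if \<open>\<alpha> > 0\<close>. For \<open>\<alpha> = 0\<close> they exclude that a
  facility profits from joining another one and being assigned all of their common clients.
\<close>

definition split_equilibrium :: "real \<Rightarrow> real \<Rightarrow> real \<Rightarrow> real \<Rightarrow> real \<Rightarrow> real \<Rightarrow> bool" where
  "split_equilibrium \<alpha> u v w b c \<longleftrightarrow>
     0 \<le> b \<and> b \<le> c \<and> c \<le> 1 \<and>
     (1 - \<alpha>) * \<bar>u - b\<bar> + \<alpha> * b = (1 - \<alpha>) * \<bar>v - b\<bar> + \<alpha> * (c - b) \<and>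
     (1 - \<alpha>) * \<bar>v - c\<bar> + \<alpha> * (c - b) = (1 - \<alpha>) * \<bar>w - c\<bar> + \<alpha> * (1 - c) \<and>
     (u = v \<longrightarrow> b = c - b) \<and> (v = w \<longrightarrow> c - b = 1 - c)"

lemma split_equilibrium_reflect:
  assumes "split_equilibrium \<alpha> u v w b c"
  shows "split_equilibrium \<alpha> (1 - w) (1 - v) (1 - u) (1 - c) (1 - b)"
proof -
  have abs: "\<bar>1 - y - (1 - z)\<bar> = \<bar>y - z\<bar>" for y z :: real by linarith
  show ?thesis using assms unfolding split_equilibrium_def abs by auto
qed

text \<open>For \<open>\<alpha> = 0\<close> the cuts are midpoints between neighbours, and
  coincident facilities share their clients equally. For \<open>\<alpha> > 0\<close> a Brouwer fixed
  point yields a common zero of two cost differences: their signs on the boundary of the unit square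
  ensure that clamping creates no spurious fixed points.\<close>

lemma split_equilibrium_exists:
  fixes \<alpha> :: real
  assumes \<alpha>: "0 \<le> \<alpha>" "\<alpha> \<le> 1" and uvw: "0 \<le> u" "u \<le> v" "v \<le> w" "w \<le> 1"
  shows "\<exists>b c. split_equilibrium \<alpha> u v w b c"
proof (cases "\<alpha> = 0")
  case True
  show ?thesis
  proof (cases "u = v"; cases "v = w")
    assume "u = v" "v = w"
    then have "split_equilibrium \<alpha> u v w (1/3) (2/3)"
      using True by (simp add: split_equilibrium_def)
    then show ?thesis by blast
  next
    assume "u = v" "v \<noteq> w"
    then have "split_equilibrium \<alpha> u v w ((v + w)/4) ((v + w)/2)"
      using True uvw by (simp add: split_equilibrium_def abs_if field_simps)
    then show ?thesis by blast
  next
    assume "u \<noteq> v" "v = w"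
    then have "split_equilibrium \<alpha> u v w ((u + v)/2) ((1 + (u + v)/2)/2)"
      using True uvw by (simp add: split_equilibrium_def abs_if field_simps)
    then show ?thesis by blast
  next
    assume "u \<noteq> v" "v \<noteq> w"
    then have "split_equilibrium \<alpha> u v w ((u + v)/2) ((v + w)/2)"
      using True uvw by (simp add: split_equilibrium_def abs_if field_simps)
    then show ?thesis by blast
  qed
next
  case False
  then have "0 < \<alpha>" using \<alpha> by simp
  \<comment> \<open>\<open>F\<close> and \<open>G\<close> are the excess costs of the left over the
    right neighbour for a client at the first and at the second cut. \<open>H\<close> moves each cut
    so as to shrink the piece of the dearer neighbour, and clamps the result to the square.\<close>
  define F where "F p = (1 - \<alpha>) * (\<bar>u - fst p\<bar> - \<bar>v - fst p\<bar>) + \<alpha> * (2 * fst p - snd p)"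
    for p :: "real \<times> real"
  define G where "G p = (1 - \<alpha>) * (\<bar>v - snd p\<bar> - \<bar>w - snd p\<bar>) + \<alpha> * (2 * snd p - fst p - 1)"
    for p :: "real \<times> real"
  define clamp01 :: "real \<Rightarrow> real" where "clamp01 z = max 0 (min 1 z)" for z
  define H where "H p = (clamp01 (fst p - F p), clamp01 (snd p - G p))" for p
  let ?S = "{0..1::real} \<times> {0..1::real}"
  have "continuous_on ?S H"
    unfolding H_def F_def G_def clamp01_def by (intro continuous_intros)
  moreover have "H \<in> ?S \<rightarrow> ?S"
    by (auto simp: H_def clamp01_def)
  moreover have "compact ?S" "convex ?S" "?S \<noteq> {}"
    by (auto intro: compact_Times convex_Times)
  ultimately obtain p where p: "p \<in> ?S" "H p = p"
    using brouwer[of ?S H] by blast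
  obtain b c where bc: "p = (b, c)" by fastforce
  have b: "0 \<le> b" "b \<le> 1" and c: "0 \<le> c" "c \<le> 1"
    using p bc by auto
  have clamp_eq: "t = 0"
    if "clamp01 (z - t) = z" "z = 0 \<Longrightarrow> t \<le> 0" "z = 1 \<Longrightarrow> 0 \<le> t" for z t
    using that by (auto simp: clamp01_def max_def min_def split: if_splits)
  have vu: "0 \<le> (1 - \<alpha>) * (v - u)" and wv: "0 \<le> (1 - \<alpha>) * (w - v)"
    using \<alpha> uvw by simp_all
  have "F p = 0"
  proof (rule clamp_eq)
    show "clamp01 (b - F p) = b" using p(2) bc by (simp add: H_def)
    show "F p \<le> 0" if "b = 0"
      using that bc vu uvw mult_nonneg_nonneg[OF \<alpha>(1) c(1)]
      by (simp add: F_def algebra_simps)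
    show "0 \<le> F p" if "b = 1"
      using that bc vu uvw mult_left_mono[OF c(2) \<alpha>(1)] \<alpha>
      by (simp add: F_def algebra_simps)
  qed
  then have F0: "(1 - \<alpha>) * (\<bar>u - b\<bar> - \<bar>v - b\<bar>) + \<alpha> * (2 * b - c) = 0"
    by (simp add: F_def bc)
  have "G p = 0"
  proof (rule clamp_eq)
    show "clamp01 (c - G p) = c" using p(2) bc by (simp add: H_def)
    show "G p \<le> 0" if "c = 0"
      using that bc wv uvw mult_nonneg_nonneg[OF \<alpha>(1) b(1)] \<alpha>
      by (simp add: G_def algebra_simps)
    show "0 \<le> G p" if "c = 1"
      using that bc wv uvw mult_left_mono[OF b(2) \<alpha>(1)] \<alpha>
      by (simp add: G_def algebra_simps)
  qed
  then have G0: "(1 - \<alpha>) * (\<bar>v - c\<bar> - \<bar>w - c\<bar>) + \<alpha> * (2 * c - b - 1) = 0"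
    by (simp add: G_def bc)
  have "b \<le> c"
  proof (rule ccontr)
    \<comment> \<open>If \<open>c < b\<close>, the load terms make \<open>F\<close> positive and
      \<open>G\<close> negative, so the distance terms must compensate: \<open>b\<close> is nearer
      to \<open>u\<close> than to \<open>v\<close>, hence left of \<open>v\<close>, while
      \<open>c\<close> is nearer to \<open>w\<close> than to \<open>v\<close>, hence right of
      \<open>v\<close>.\<close>
    assume "\<not> b \<le> c"
    then have "0 < \<alpha> * (2 * b - c)" "\<alpha> * (2 * c - b - 1) < 0"
      using \<open>0 < \<alpha>\<close> b c by (simp_all add: mult_pos_neg)
    then have "(1 - \<alpha>) * (\<bar>u - b\<bar> - \<bar>v - b\<bar>) < 0" "0 < (1 - \<alpha>) * (\<bar>v - c\<bar> - \<bar>w - c\<bar>)"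
      using F0 G0 by linarith+
    then have "\<bar>u - b\<bar> < \<bar>v - b\<bar>" "\<bar>w - c\<bar> < \<bar>v - c\<bar>"
      using \<alpha> by (auto simp: mult_less_0_iff zero_less_mult_iff)
    then show False using uvw \<open>\<not> b \<le> c\<close> by linarith
  qed
  moreover have "b = c - b" if "u = v"
    using F0 that \<open>0 < \<alpha>\<close> by simp
  moreover have "c - b = 1 - c" if "v = w"
    using G0 that \<open>0 < \<alpha>\<close> by simp
  ultimately have "split_equilibrium \<alpha> u v w b c"
    unfolding split_equilibrium_def using b c F0 G0
    by (simp add: algebra_simps)
  then show ?thesis by blast
qed

section \<open>Load bounds for a facility in an outer or the middle position\<close>

text \<open>The alternatives are the combinations of \<open>c \<le> q\<close> or
  \<open>q < c\<close> with \<open>b \<le> p\<close> or \<open>p < b\<close>. None of them mentions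
  \<open>y\<close>: if \<open>b \<le> p\<close>, only \<open>\<bar>y - b\<bar> \<ge> 0\<close> is
  used, with equality when the cut lies at the deviator; if \<open>p < b\<close>, the facility at
  \<open>p\<close> is at least as near to the cut and so must carry at least the load
  \<open>b\<close>. The third alternative records two upper bounds on \<open>b\<close>, since the
  positions of \<open>p\<close> and \<open>q\<close> decide which of them is useful.\<close>

lemma split_equilibrium_left_load:
  fixes \<alpha> :: real
  assumes \<alpha>: "0 \<le> \<alpha>" "\<alpha> \<le> 1" and split: "split_equilibrium \<alpha> y p q b c"
    and "y \<le> p" "p < q" and K: "K = (1 - \<alpha>) * (p + q) + \<alpha>"
  shows "(2 + 2 * \<alpha> - \<alpha>\<^sup>2) * b \<le> \<alpha> * K + 2 * (1 - \<alpha>) * p \<or> (4 - \<alpha>) * b \<le> K \<or>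
    q < c \<and> c - b \<le> 1 - c \<and> b \<le> \<alpha> * (1 - q) + (1 - \<alpha>) * (2 * p - q) \<and>
      (2 + \<alpha>) * b \<le> \<alpha> + (1 - \<alpha>) * (3 * p - q) \<or>
    q < c \<and> b \<le> c - b \<and> c - b \<le> 1 - c"
proof -
  have e1: "(1 - \<alpha>) * \<bar>y - b\<bar> + \<alpha> * b = (1 - \<alpha>) * \<bar>p - b\<bar> + \<alpha> * (c - b)"
    and e2: "(1 - \<alpha>) * \<bar>p - c\<bar> + \<alpha> * (c - b) = (1 - \<alpha>) * \<bar>q - c\<bar> + \<alpha> * (1 - c)"
    and coloc: "y = p \<Longrightarrow> b = c - b"
    using split by (auto simp: split_equilibrium_def)
  have left: "b \<le> \<alpha> * (c - b) + (1 - \<alpha>) * p" if "b \<le> p"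
  proof -
    have "0 \<le> (1 - \<alpha>) * \<bar>y - b\<bar>" using \<alpha> by simp
    then have "\<alpha> * b \<le> (1 - \<alpha>) * (p - b) + \<alpha> * (c - b)" using e1 that by simp
    then show ?thesis by (simp add: algebra_simps)
  qed
  have left': "b \<le> c - b" if "p < b"
  proof (cases "y = p")
    case False
    then have pos: "\<bar>p - b\<bar> < \<bar>y - b\<bar>" using that \<open>y \<le> p\<close> by linarith
    then have "\<alpha> * b \<le> \<alpha> * (c - b)"
      using e1 mult_left_mono[of "\<bar>p - b\<bar>" "\<bar>y - b\<bar>" "1 - \<alpha>"] \<alpha> by linarith
    moreover have "\<alpha> \<noteq> 0" using e1 pos by auto
    ultimately show ?thesis using \<alpha> by (simp add: mult_le_cancel_left)
  qed (use coloc in auto)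
  show ?thesis
  proof (cases "c \<le> q")
    case True
    have "(1 - \<alpha>) * (c - p) \<le> (1 - \<alpha>) * \<bar>p - c\<bar>" using \<alpha> by (intro mult_left_mono) auto
    then have KK: "(2 - \<alpha>) * c + \<alpha> * (c - b) \<le> K"
      using e2 True unfolding K by (simp add: algebra_simps)
    show ?thesis
    proof (cases "b \<le> p")
      case True
      \<comment> \<open>Doubling \<open>left\<close> and adding this inequality cancels
        \<open>c\<close>; this is the origin of the factor
        \<open>2 + 2 * \<alpha> - \<alpha>\<^sup>2\<close>.\<close>
      have "\<alpha> * ((2 - \<alpha>) * c + \<alpha> * (c - b)) \<le> \<alpha> * K"
        using KK \<alpha> by (intro mult_left_mono)
      then have "(2 + 2 * \<alpha> - \<alpha>\<^sup>2) * b \<le> \<alpha> * K + 2 * (1 - \<alpha>) * p"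
        using left[OF True] by (simp add: algebra_simps power2_eq_square)
      then show ?thesis by blast
    next
      case False
      have "2 * (2 * b) \<le> 2 * c" using left' False by simp
      then have "(4 - \<alpha>) * b \<le> (2 - \<alpha>) * c + \<alpha> * (c - b)"
        by (simp add: algebra_simps)
      then show ?thesis using KK by linarith
    qed
  next
    case False
    then have e2': "(1 - \<alpha>) * (q - p) + \<alpha> * (c - b) = \<alpha> * (1 - c)"
      using e2 \<open>p < q\<close> by (simp add: algebra_simps)
    have "0 \<le> (1 - \<alpha>) * (q - p)" using \<alpha> \<open>p < q\<close> by simp
    then have "\<alpha> * (c - b) \<le> \<alpha> * (1 - c)" using e2' by linarith
    moreover have "\<alpha> \<noteq> 0" using e2' \<open>p < q\<close> by auto
    ultimately have m: "c - b \<le> 1 - c" using \<alpha> by (simp add: mult_le_cancel_left)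
    show ?thesis
    proof (cases "b \<le> p")
      case True
      have "\<alpha> * (1 - c) \<le> \<alpha> * (1 - q)" using False \<alpha> by (intro mult_left_mono) auto
      then have "b \<le> \<alpha> * (1 - q) + (1 - \<alpha>) * (2 * p - q)"
        using e2' left[OF True] by (simp add: algebra_simps)
      moreover have "(2 + \<alpha>) * b \<le> \<alpha> + (1 - \<alpha>) * (3 * p - q)"
        using e2' left[OF True] by (simp add: algebra_simps)
      ultimately show ?thesis using False m by linarith
    next
      assume "\<not> b \<le> p"
      then show ?thesis using left' m False by linarith
    qed
  qed
qed

text \<open>Each cut either stays on the inner side of the adjacent outer facility or lies beyond
  it. \<open>left\<close> treats the first cut, and its instance for the reflected configuration
  treats the second. In the first three alternatives, adding the relation for \<open>b\<close> to
  that for \<open>c\<close> cancels \<open>y\<close>; in the last, comparing the loads is enough for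
  later use.\<close>

lemma split_equilibrium_middle_load:
  fixes \<alpha> :: real
  assumes \<alpha>: "0 \<le> \<alpha>" "\<alpha> \<le> 1" and split: "split_equilibrium \<alpha> p y q b c"
    and "p \<le> y" "y \<le> q"
  shows "(2 + \<alpha>) * (c - b) \<le> \<alpha> + (1 - \<alpha>) * (q - p) \<or>
    (4 - \<alpha>) * (c - b) \<le> (1 - \<alpha>) * (p + q) + \<alpha> \<or>
    (4 - \<alpha>) * (c - b) \<le> (1 - \<alpha>) * (2 - p - q) + \<alpha> \<or>
    b < p \<and> q < c \<and> c - b \<le> b \<and> c - b \<le> 1 - c"
proof -
  have left: "\<alpha> * (c - b) + (1 - \<alpha>) * (p + y) \<le> (2 - \<alpha>) * b \<or>
      b < p \<and> c - b \<le> b \<and> \<alpha> * b = \<alpha> * (c - b) + (1 - \<alpha>) * (y - p)"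
    if "split_equilibrium \<alpha> p y q b c" "p \<le> y" "y \<le> q" for p y q b c
  proof -
    have e1: "(1 - \<alpha>) * \<bar>p - b\<bar> + \<alpha> * b = (1 - \<alpha>) * \<bar>y - b\<bar> + \<alpha> * (c - b)"
      and coloc: "p = y \<Longrightarrow> b = c - b"
      using that by (auto simp: split_equilibrium_def)
    show ?thesis
    proof (cases "p \<le> b")
      case True
      have "(1 - \<alpha>) * (y - b) \<le> (1 - \<alpha>) * \<bar>y - b\<bar>" using \<alpha> by (intro mult_left_mono) auto
      then show ?thesis using e1 True by (simp add: algebra_simps)
    next
      case False
      then have e1': "\<alpha> * b = \<alpha> * (c - b) + (1 - \<alpha>) * (y - p)"
        using e1 \<open>p \<le> y\<close> by (simp add: algebra_simps)
      moreover have "c - b \<le> b"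
      proof (cases "p = y")
        case False
        have "0 \<le> (1 - \<alpha>) * (y - p)" using \<alpha> \<open>p \<le> y\<close> by simp
        then have "\<alpha> * (c - b) \<le> \<alpha> * b" using e1' by linarith
        moreover have "\<alpha> \<noteq> 0" using e1' False by auto
        ultimately show ?thesis using \<alpha> by (simp add: mult_le_cancel_left)
      qed (use coloc in auto)
      ultimately show ?thesis using False by auto
    qed
  qed
  have scale: "(1 - \<alpha>) * (c - b) \<le> (1 - \<alpha>) * b" if "c - b \<le> b" for b c :: real
    using that \<alpha> by (intro mult_left_mono) auto
  from left[OF split \<open>p \<le> y\<close> \<open>y \<le> q\<close>]
  consider (l1) "\<alpha> * (c - b) + (1 - \<alpha>) * (p + y) \<le> (2 - \<alpha>) * b"
    | (l2) "b < p" "c - b \<le> b" "\<alpha> * b = \<alpha> * (c - b) + (1 - \<alpha>) * (y - p)" by blast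
  note l = this
  from left[OF split_equilibrium_reflect[OF split]] assms(4,5)
  consider (r1) "\<alpha> * (c - b) + (1 - \<alpha>) * (1 - q + (1 - y)) \<le> (2 - \<alpha>) * (1 - c)"
    | (r2) "q < c" "c - b \<le> 1 - c" "\<alpha> * (1 - c) = \<alpha> * (c - b) + (1 - \<alpha>) * (q - y)" by auto
  then show ?thesis
  proof cases
    case r1
    from l show ?thesis
    proof cases
      case l1
      then have "(2 + \<alpha>) * (c - b) \<le> \<alpha> + (1 - \<alpha>) * (q - p)"
        using r1 by (simp add: algebra_simps)
      then show ?thesis by blast
    next
      case l2
      then have "(4 - \<alpha>) * (c - b) \<le> (1 - \<alpha>) * (p + q) + \<alpha>"
        using r1 scale[OF l2(2)] by (simp add: algebra_simps)
      then show ?thesis by blast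
    qed
  next
    case r2
    from l show ?thesis
    proof cases
      case l1
      have "(1 - \<alpha>) * (c - b) \<le> (1 - \<alpha>) * (1 - c)"
        using r2 \<alpha> by (intro mult_left_mono) auto
      then have "(4 - \<alpha>) * (c - b) \<le> (1 - \<alpha>) * (2 - p - q) + \<alpha>"
        using l1 r2(3) by (simp add: algebra_simps)
      then show ?thesis by blast
    qed (use r2 in blast)
  qed
qed

text \<open>The bound \<open>x \<le> 1/3\<close> keeps each cut between its two facilities, where
  the absolute values resolve and the cost equations are linear. Their sum gives the symmetry. Since
  the cuts are thereby unique, the loads at these locations do not depend on which equilibrium a
  client mapping selects.\<close>

lemma split_equilibrium_base:
  fixes \<alpha> :: real
  assumes \<alpha>: "0 \<le> \<alpha>" "\<alpha> \<le> 1" and split: "split_equilibrium \<alpha> x (1/2) (1 - x) b c"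
    and "0 \<le> x" "x \<le> 1/3"
  shows "c = 1 - b" "(2 + \<alpha>) * b = \<alpha> + (1 - \<alpha>) * (1/2 + x)"
proof -
  have inner: "x \<le> b \<and> b \<le> 1/2" if "split_equilibrium \<alpha> x (1/2) (1 - x) b c" for b c
  proof -
    have bc: "0 \<le> b" "b \<le> c" "c \<le> 1"
      and e1: "(1 - \<alpha>) * \<bar>x - b\<bar> + \<alpha> * b = (1 - \<alpha>) * \<bar>1/2 - b\<bar> + \<alpha> * (c - b)"
      and e2: "(1 - \<alpha>) * \<bar>1/2 - c\<bar> + \<alpha> * (c - b) = (1 - \<alpha>) * \<bar>1 - x - c\<bar> + \<alpha> * (1 - c)"
      using that by (auto simp: split_equilibrium_def)
    have gap: "0 \<le> (1 - \<alpha>) * (1/2 - x)" using \<alpha> assms(5) by simp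
    have "\<not> 1/2 < b"
    proof
      assume "1/2 < b"
      then have *: "(1 - \<alpha>) * (1/2 - x) + \<alpha> * b = \<alpha> * (c - b)"
        using e1 assms(5) by (simp add: algebra_simps)
      have "\<alpha> \<noteq> 0" using * assms(5) by auto
      moreover have "\<alpha> * b \<le> \<alpha> * (c - b)" using * gap by linarith
      ultimately have "b \<le> c - b" using \<alpha> by (simp add: mult_le_cancel_left)
      then show False using \<open>1/2 < b\<close> bc by linarith
    qed
    moreover have "\<not> b < x"
    proof
      \<comment> \<open>In this case all three loads are at most \<open>b\<close>, so
        \<open>1/3 \<le> b < x\<close>, against \<open>x \<le> 1/3\<close>.\<close>
      assume "b < x"
      then have *: "\<alpha> * b = (1 - \<alpha>) * (1/2 - x) + \<alpha> * (c - b)"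
        using e1 assms(5) by (simp add: algebra_simps)
      have "\<alpha> \<noteq> 0" using * assms(5) by auto
      have "\<alpha> * (c - b) \<le> \<alpha> * b" using * gap by linarith
      then have "c - b \<le> b" using \<alpha> \<open>\<alpha> \<noteq> 0\<close> by (simp add: mult_le_cancel_left)
      then have c: "c < 2 * x" using \<open>b < x\<close> by linarith
      then have "(1 - \<alpha>) * (\<bar>1/2 - c\<bar> - \<bar>1 - x - c\<bar>) \<le> (1 - \<alpha>) * (1/2 - x)"
        using \<alpha> assms(5) by (intro mult_left_mono) linarith+
      then have "\<alpha> * (1 - c) \<le> \<alpha> * b" using * e2 by (simp add: algebra_simps)
      then have "1 - c \<le> b" using \<alpha> \<open>\<alpha> \<noteq> 0\<close> by (simp add: mult_le_cancel_left)
      then show False using c \<open>b < x\<close> assms(5) by linarith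
    qed
    ultimately show ?thesis by linarith
  qed
  have "x \<le> b" "b \<le> 1/2" using inner[OF split] by auto
  moreover have "1/2 \<le> c" "c \<le> 1 - x"
    using inner[of "1 - c" "1 - b"] split_equilibrium_reflect[OF split] by auto
  ultimately have "(1 - \<alpha>) * (b - x) + \<alpha> * b = (1 - \<alpha>) * (1/2 - b) + \<alpha> * (c - b)"
      "(1 - \<alpha>) * (c - 1/2) + \<alpha> * (c - b) = (1 - \<alpha>) * (1 - x - c) + \<alpha> * (1 - c)"
    using split by (auto simp: split_equilibrium_def)
  then have e: "2 * b = \<alpha> * c + (1 - \<alpha>) * (1/2 + x)"
      "2 * c = \<alpha> * b + \<alpha> + (1 - \<alpha>) * (3/2 - x)"
    by (simp_all add: field_simps)
  then have "(2 - \<alpha>) * (b + c) = (2 - \<alpha>) * 1" by (simp add: field_simps)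
  then have "b + c = 1" using \<alpha> by simp
  then show c: "c = 1 - b" by simp
  show "(2 + \<alpha>) * b = \<alpha> + (1 - \<alpha>) * (1/2 + x)"
    using e(1) unfolding c by (simp add: algebra_simps)
qed

section \<open>Bounds for all deviations from the chosen locations\<close>

text \<open>Both bounds come from the first alternative of
  \<open>split_equilibrium_left_load\<close>: \<open>p = 1/2\<close> and \<open>q = 1 - x\<close>
  for a deviating outer facility, \<open>p = x\<close> and \<open>q = 1 - x\<close> for the middle
  one.\<close>

definition outer_bound :: "real \<Rightarrow> real \<Rightarrow> real" where
  "outer_bound \<alpha> x = (1 + \<alpha> * (1 - \<alpha>) * (1/2 - x)) / (2 + 2 * \<alpha> - \<alpha>\<^sup>2)"

definition middle_bound :: "real \<Rightarrow> real \<Rightarrow> real" where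
  "middle_bound \<alpha> x = (\<alpha> + 2 * (1 - \<alpha>) * x) / (2 + 2 * \<alpha> - \<alpha>\<^sup>2)"

lemma denominator_pos: "0 < 2 + 2 * \<alpha> - \<alpha>\<^sup>2" if "0 \<le> \<alpha>" "\<alpha> \<le> 1" for \<alpha> :: real
proof -
  have "\<alpha>\<^sup>2 \<le> \<alpha>" using that by (simp add: power2_eq_square mult_left_le)
  then show ?thesis using that by linarith
qed

text \<open>The cases are the ranks that the left outer facility and, up to reflection, the middle
  facility can take after moving. The remaining alternatives of the load lemmas turn out to be no
  better or impossible; \<open>1 \<le> (4 - \<alpha>) * x\<close> serves to infer
  \<open>z \<le> x\<close> from \<open>(4 - \<alpha>) * z \<le> 1\<close>. The second argument of
  \<open>max\<close> is the load of the middle facility before it moves.\<close>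

lemma split_equilibrium_deviation_bounds:
  fixes \<alpha> x :: real
  assumes \<alpha>: "0 \<le> \<alpha>" "\<alpha> \<le> 1" and x: "1 \<le> (4 - \<alpha>) * x" "x \<le> 1/3"
  shows split_equilibrium_outer_left:
      "split_equilibrium \<alpha> y (1/2) (1 - x) b c \<Longrightarrow> y \<le> 1/2 \<Longrightarrow> b \<le> outer_bound \<alpha> x"
    and split_equilibrium_outer_middle:
      "split_equilibrium \<alpha> (1/2) y (1 - x) b c \<Longrightarrow> 1/2 \<le> y \<Longrightarrow> y \<le> 1 - x \<Longrightarrow>
        c - b \<le> outer_bound \<alpha> x"
    and split_equilibrium_outer_right:
      "split_equilibrium \<alpha> (1/2) (1 - x) y b c \<Longrightarrow> 1 - x \<le> y \<Longrightarrow> 1 - c \<le> outer_bound \<alpha> x"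
    and split_equilibrium_middle_left:
      "split_equilibrium \<alpha> y x (1 - x) b c \<Longrightarrow> y \<le> x \<Longrightarrow> b \<le> middle_bound \<alpha> x"
    and split_equilibrium_middle_middle:
      "split_equilibrium \<alpha> x y (1 - x) b c \<Longrightarrow> x \<le> y \<Longrightarrow> y \<le> 1 - x \<Longrightarrow>
        c - b \<le> max (middle_bound \<alpha> x) ((\<alpha> + (1 - \<alpha>) * (1 - 2 * x)) / (2 + \<alpha>))"
proof -
  let ?D = "2 + 2 * \<alpha> - \<alpha>\<^sup>2"
  let ?O = "1 + \<alpha> * (1 - \<alpha>) * (1/2 - x)"
  let ?M = "\<alpha> + 2 * (1 - \<alpha>) * x"
  have D: "0 < ?D" using denominator_pos \<alpha> by blast
  have x0: "0 < x" using x(1) \<alpha> by (smt (verit) mult_nonneg_nonpos)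
  have x4: "1/4 \<le> x" using x(1) mult_nonneg_nonneg[OF \<alpha>(1), of x] x0
    by (simp add: algebra_simps)
  have aa: "0 \<le> \<alpha> * (1 - \<alpha>)" using \<alpha> by simp
  have outerI: "z \<le> outer_bound \<alpha> x" if "?D * z \<le> ?O" for z
    using that D by (simp add: outer_bound_def field_simps)
  have middleI: "z \<le> middle_bound \<alpha> x" if "?D * z \<le> ?M" for z
    using that D by (simp add: middle_bound_def field_simps)
  \<comment> \<open>The denominator is \<open>3 - (1 - \<alpha>)\<^sup>2\<close>, hence at most 3.
    This settles every alternative in which the outer deviator's load is at most each of the other
    two loads.\<close>
  have third: "1/3 \<le> outer_bound \<alpha> x"
  proof (rule outerI)
    have "0 \<le> \<alpha> * (1 - \<alpha>) * (1/2 - x)" using aa x by simp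
    moreover have "0 \<le> (1 - \<alpha>)\<^sup>2" by simp
    ultimately show "?D * (1/3) \<le> ?O" by (simp add: power2_eq_square algebra_simps)
  qed
  have K_outer: "z \<le> outer_bound \<alpha> x" if "(4 - \<alpha>) * z \<le> (1 - \<alpha>) * (3/2 - x) + \<alpha>" for z
  proof (rule outerI)
    \<comment> \<open>The denominator equals
      \<open>\<alpha> * (4 - \<alpha>) + 2 * (1 - \<alpha>)\<close>, so the claim combines the
      hypothesis on \<open>(4 - \<alpha>) * z\<close> and \<open>2 * z \<le> 1\<close> with weights
      \<open>\<alpha>\<close> and \<open>1 - \<alpha>\<close>.\<close>
    have "?D * z = \<alpha> * ((4 - \<alpha>) * z) + (1 - \<alpha>) * (2 * z)"
      by (simp add: algebra_simps power2_eq_square)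
    also have "\<dots> \<le> \<alpha> * ((1 - \<alpha>) * (3/2 - x) + \<alpha>) + (1 - \<alpha>) * 1"
    proof (intro add_mono mult_left_mono that)
      have "(1 - \<alpha>) * (3/2 - x) \<le> (1 - \<alpha>) * (3/2)" using \<alpha> x0 by (intro mult_left_mono) auto
      then have "(4 - \<alpha>) * z \<le> (4 - \<alpha>) * (1/2)" using that by (simp add: field_simps)
      then show "2 * z \<le> 1" using \<alpha> by (simp add: mult_le_cancel_left)
    qed (use \<alpha> in auto)
    also have "\<dots> = ?O" by (simp add: field_simps power2_eq_square)
    finally show "?D * z \<le> ?O" .
  qed
  have K_middle: "z \<le> middle_bound \<alpha> x" if "(4 - \<alpha>) * z \<le> 1" for z
  proof (rule middleI)
    have "(4 - \<alpha>) * z \<le> (4 - \<alpha>) * x" using that x by linarith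
    then have "z \<le> x" using \<alpha> by (simp add: mult_le_cancel_left)
    then have "\<alpha> * ((4 - \<alpha>) * z) + (1 - \<alpha>) * (2 * z) \<le> \<alpha> * 1 + (1 - \<alpha>) * (2 * x)"
      using \<alpha> that by (intro add_mono mult_left_mono) auto
    then show "?D * z \<le> ?M" by (simp add: algebra_simps power2_eq_square)
  qed
  show "b \<le> outer_bound \<alpha> x" if s: "split_equilibrium \<alpha> y (1/2) (1 - x) b c" and y: "y \<le> 1/2"
    for y b c
  proof -
    have "1/2 < 1 - x" using x by linarith
    from split_equilibrium_left_load[OF \<alpha> s y this refl]
    consider "?D * b \<le> ?O" | "(4 - \<alpha>) * b \<le> (1 - \<alpha>) * (3/2 - x) + \<alpha>"
      | "b \<le> x" | "b \<le> c - b" "c - b \<le> 1 - c"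
      by (fastforce simp: field_simps power2_eq_square)
    then show ?thesis
    proof cases
      case 3 then show ?thesis using third x by linarith
    next
      case 4 then show ?thesis using third by linarith
    qed (use outerI K_outer in blast)+
  qed
  show "c - b \<le> outer_bound \<alpha> x"
    if s: "split_equilibrium \<alpha> (1/2) y (1 - x) b c" and y: "1/2 \<le> y" "y \<le> 1 - x" for y b c
  proof -
    from split_equilibrium_middle_load[OF \<alpha> s y]
    consider (a) "(2 + \<alpha>) * (c - b) \<le> \<alpha> + (1 - \<alpha>) * (1/2 - x)"
      | (b) "(4 - \<alpha>) * (c - b) \<le> (1 - \<alpha>) * (3/2 - x) + \<alpha>"
      | (c) "(4 - \<alpha>) * (c - b) \<le> (1 - \<alpha>) * (1/2 + x) + \<alpha>"
      | (d) "c - b \<le> b" "c - b \<le> 1 - c"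
      by (fastforce simp: field_simps)
    then show ?thesis
    proof cases
      case a
      have "(1 - \<alpha>) * (1/2 - x) \<le> (1 - \<alpha>) * (1/4)" using \<alpha> x
        by (intro mult_left_mono) (use x4 in linarith)+
      then have "(2 + \<alpha>) * (c - b) \<le> (2 + \<alpha>) * (1/3)" using a \<alpha> by (simp add: field_simps)
      then have "c - b \<le> 1/3" using \<alpha> by (simp add: mult_le_cancel_left)
      then show ?thesis using third by linarith
    next
      case c
      have "(1 - \<alpha>) * (1/2 + x) \<le> (1 - \<alpha>) * (3/2 - x)" using \<alpha> x by (intro mult_left_mono) auto
      then show ?thesis using c K_outer[of "c - b"] by linarith
    next
      case d then show ?thesis using third by linarith
    qed (use K_outer in blast)
  qed
  show "1 - c \<le> outer_bound \<alpha> x"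
    if s: "split_equilibrium \<alpha> (1/2) (1 - x) y b c" and y: "1 - x \<le> y" for y b c
  proof -
    have s': "split_equilibrium \<alpha> (1 - y) x (1/2) (1 - c) (1 - b)"
      using split_equilibrium_reflect[OF s] by simp
    have y': "1 - y \<le> x" "x < 1/2" using y x by linarith+
    have K: "(1 - \<alpha>) * (x + 1/2) \<le> (1 - \<alpha>) * (3/2 - x)" using \<alpha> x by (intro mult_left_mono) auto
    from split_equilibrium_left_load[OF \<alpha> s' y' refl]
    consider (a) "?D * (1 - c) \<le> \<alpha> * ((1 - \<alpha>) * (x + 1/2) + \<alpha>) + 2 * (1 - \<alpha>) * x"
      | (b) "(4 - \<alpha>) * (1 - c) \<le> (1 - \<alpha>) * (x + 1/2) + \<alpha>"
      | (c) "(2 + \<alpha>) * (1 - c) \<le> \<alpha> + (1 - \<alpha>) * (3 * x - 1/2)"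
      | (d) "1 - c \<le> c - b" "c - b \<le> b" by fastforce
    then show ?thesis
    proof cases
      case a
      have "\<alpha> * ((1 - \<alpha>) * (x + 1/2)) \<le> \<alpha> * ((1 - \<alpha>) * (3/2 - x))"
        using K \<alpha>(1) by (rule mult_left_mono)
      moreover have "2 * ((1 - \<alpha>) * x) \<le> 2 * ((1 - \<alpha>) * (1/2))"
        using \<alpha> x by (intro mult_left_mono) auto
      ultimately have "?D * (1 - c) \<le> ?O"
        using a by (simp add: field_simps power2_eq_square)
      then show ?thesis by (rule outerI)
    next
      case b then show ?thesis using K K_outer[of "1 - c"] by linarith
    next
      case c
      have "(1 - \<alpha>) * (3 * x - 1/2) \<le> (1 - \<alpha>) * (1/2)" using \<alpha> x by (intro mult_left_mono) auto
      then have "(2 + \<alpha>) * (1 - c) \<le> (2 + \<alpha>) * (1/3)" using c \<alpha> by (simp add: field_simps)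
      then have "1 - c \<le> 1/3" using \<alpha> by (simp add: mult_le_cancel_left)
      then show ?thesis using third by linarith
    next
      case d then show ?thesis using third by linarith
    qed
  qed
  show "b \<le> middle_bound \<alpha> x" if s: "split_equilibrium \<alpha> y x (1 - x) b c" and y: "y \<le> x" for y b c
  proof -
    have "x < 1 - x" using x by linarith
    from split_equilibrium_left_load[OF \<alpha> s y this refl]
    consider (a) "?D * b \<le> ?M" | (b) "(4 - \<alpha>) * b \<le> 1"
      | (c) "1 - x < c" "c - b \<le> 1 - c" "b \<le> \<alpha> * x + (1 - \<alpha>) * (3 * x - 1)"
      | (d) "1 - x < c" "b \<le> c - b" "c - b \<le> 1 - c" by (fastforce simp: algebra_simps)
    then show ?thesis
    proof cases
      \<comment> \<open>The third load is below \<open>x\<close> and the other two are at most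
        \<open>x\<close>, so the loads would sum to less than \<open>3 * x \<le> 1\<close>. Case
        \<open>d\<close> is impossible for the same reason.\<close>
      case c
      have "(1 - \<alpha>) * (3 * x - 1) \<le> (1 - \<alpha>) * x" using \<alpha> x by (intro mult_left_mono) auto
      then have "b \<le> x" using c(3) by (simp add: algebra_simps)
      then show ?thesis using c x by linarith
    next
      case d then show ?thesis using x by linarith
    qed (use middleI K_middle in blast)+
  qed
  show "c - b \<le> max (middle_bound \<alpha> x) ((\<alpha> + (1 - \<alpha>) * (1 - 2 * x)) / (2 + \<alpha>))"
    if s: "split_equilibrium \<alpha> x y (1 - x) b c" and y: "x \<le> y" "y \<le> 1 - x" for y b c
  proof -
    from split_equilibrium_middle_load[OF \<alpha> s y]
    consider (a) "(2 + \<alpha>) * (c - b) \<le> \<alpha> + (1 - \<alpha>) * (1 - 2 * x)"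
      | (b) "(4 - \<alpha>) * (c - b) \<le> 1"
      | (d) "b < x" "1 - x < c" "c - b \<le> b" "c - b \<le> 1 - c"
      by (fastforce simp: algebra_simps)
    then show ?thesis
    proof cases
      case a
      then have "c - b \<le> (\<alpha> + (1 - \<alpha>) * (1 - 2 * x)) / (2 + \<alpha>)"
        using \<alpha> by (simp add: field_simps)
      then show ?thesis by simp
    next
      case b then show ?thesis using K_middle by (meson max.coboundedI1)
    next
      case d then show ?thesis using x by linarith
    qed
  qed
qed

section \<open>The location that balances the gains, and the resulting ratio\<close>

text \<open>The equation arises from \<open>outer_bound \<alpha> x / b = middle_bound \<alpha> x /
  (1 - 2 * b)\<close>, with \<open>b\<close> the outer load of
  \<open>split_equilibrium_base\<close>, by clearing denominators and cancelling
  \<open>1 - \<alpha>\<close>. The intermediate value theorem finds a root; the endpoints are the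
  limits that the deviation bounds impose on \<open>x\<close>.\<close>

lemma optimal_location_exists:
  fixes \<alpha> :: real
  assumes \<alpha>: "0 \<le> \<alpha>" "\<alpha> \<le> 1"
  shows "\<exists>x. 1 \<le> (4 - \<alpha>) * x \<and> x \<le> 1/3 \<and>
    2 * (1 - \<alpha>)\<^sup>2 * x\<^sup>2 + (3 + 4 * \<alpha> - \<alpha>\<^sup>2) * x = 1 + \<alpha>"
proof -
  define P where "P x = 2 * (1 - \<alpha>)\<^sup>2 * x\<^sup>2 + (3 + 4 * \<alpha> - \<alpha>\<^sup>2) * x" for x
  have fac: "0 \<le> (2 + \<alpha>) * (1 - \<alpha>)" using \<alpha> by simp
  have "\<exists>x\<ge>1 / (4 - \<alpha>). x \<le> 1/3 \<and> P x = 1 + \<alpha>"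
  proof (rule IVT')
    have "P r * (4 - \<alpha>)\<^sup>2 = 2 * (1 - \<alpha>)\<^sup>2 * (r * (4 - \<alpha>))\<^sup>2 +
        (3 + 4 * \<alpha> - \<alpha>\<^sup>2) * (r * (4 - \<alpha>)) * (4 - \<alpha>)" for r
      by (simp add: P_def algebra_simps power2_eq_square)
    then have "P (1 / (4 - \<alpha>)) * (4 - \<alpha>)\<^sup>2 =
        2 * (1 - \<alpha>)\<^sup>2 + (3 + 4 * \<alpha> - \<alpha>\<^sup>2) * (4 - \<alpha>)"
      using \<alpha> by simp
    also have "\<dots> = (1 + \<alpha>) * (4 - \<alpha>)\<^sup>2 - (2 + \<alpha>) * (1 - \<alpha>)"
      by (simp add: algebra_simps power2_eq_square)
    also have "\<dots> \<le> (1 + \<alpha>) * (4 - \<alpha>)\<^sup>2" using fac by simp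
    finally show "P (1 / (4 - \<alpha>)) \<le> 1 + \<alpha>" using \<alpha> by (simp add: mult_le_cancel_right)
    have "P (1/3) = 1 + \<alpha> + (2 + \<alpha>) * (1 - \<alpha>) / 9"
      by (simp add: P_def field_simps power2_eq_square)
    then show "1 + \<alpha> \<le> P (1/3)" using fac by simp
    show "1 / (4 - \<alpha>) \<le> 1/3" using \<alpha> by (simp add: field_simps)
    show "continuous_on {1 / (4 - \<alpha>)..1/3} P" unfolding P_def by (intro continuous_intros)
  qed
  then show ?thesis using \<alpha> by (auto simp: P_def field_simps)
qed

text \<open>The square of \<open>2 * ?R - (1 - \<alpha>\<^sup>2)\<close> differs from the radicand
  by \<open>8 * (1 - \<alpha>)\<^sup>2\<close> times the equation for \<open>x\<close>. Verifying
  the root in this way, instead of solving for \<open>x\<close>, avoids dividing by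
  \<open>1 - \<alpha>\<close> and so covers \<open>\<alpha> = 1\<close>.\<close>

lemma ratio_eq:
  fixes \<alpha> x :: real
  assumes \<alpha>: "0 \<le> \<alpha>" "\<alpha> \<le> 1" and x: "0 \<le> x"
    "2 * (1 - \<alpha>)\<^sup>2 * x\<^sup>2 + (3 + 4 * \<alpha> - \<alpha>\<^sup>2) * x = 1 + \<alpha>"
    and D: "0 < 2 + 2 * \<alpha> - \<alpha>\<^sup>2"
  shows "(1 - \<alpha>\<^sup>2 + sqrt (17 + \<alpha> * (16 + 2 * \<alpha> + \<alpha> ^ 3))) / (4 - 2 * (\<alpha> - 2) * \<alpha>) =
    1 + 2 * (1 - \<alpha>)\<^sup>2 * x / (2 + 2 * \<alpha> - \<alpha>\<^sup>2)"
proof -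
  let ?R = "2 + 2 * \<alpha> - \<alpha>\<^sup>2 + 2 * (1 - \<alpha>)\<^sup>2 * x"
  have "sqrt (17 + \<alpha> * (16 + 2 * \<alpha> + \<alpha> ^ 3)) = 2 * ?R - (1 - \<alpha>\<^sup>2)"
  proof (rule real_sqrt_unique)
    have "(2 * ?R - (1 - \<alpha>\<^sup>2))\<^sup>2 - (17 + \<alpha> * (16 + 2 * \<alpha> + \<alpha> ^ 3)) =
        8 * (1 - \<alpha>)\<^sup>2 * (2 * (1 - \<alpha>)\<^sup>2 * x\<^sup>2 + (3 + 4 * \<alpha> - \<alpha>\<^sup>2) * x - (1 + \<alpha>))"
      by (simp add: algebra_simps power2_eq_square power3_eq_cube)
    then show "(2 * ?R - (1 - \<alpha>\<^sup>2))\<^sup>2 = 17 + \<alpha> * (16 + 2 * \<alpha> + \<alpha> ^ 3)" using x(2) by simp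
    have "\<alpha>\<^sup>2 \<le> \<alpha>" using \<alpha> by (simp add: power2_eq_square mult_left_le)
    then have "0 \<le> 3 + 4 * \<alpha> - \<alpha>\<^sup>2" using \<alpha> by linarith
    moreover have "2 * ?R - (1 - \<alpha>\<^sup>2) = (3 + 4 * \<alpha> - \<alpha>\<^sup>2) + 4 * (1 - \<alpha>)\<^sup>2 * x" by simp
    moreover have "0 \<le> 4 * (1 - \<alpha>)\<^sup>2 * x" using x(1) by simp
    ultimately show "0 \<le> 2 * ?R - (1 - \<alpha>\<^sup>2)" by (metis add_nonneg_nonneg)
  qed
  then have "1 - \<alpha>\<^sup>2 + sqrt (17 + \<alpha> * (16 + 2 * \<alpha> + \<alpha> ^ 3)) = 2 * ?R" by linarith
  moreover have "4 - 2 * (\<alpha> - 2) * \<alpha> = 2 * (2 + 2 * \<alpha> - \<alpha>\<^sup>2)"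
    by (simp add: algebra_simps power2_eq_square)
  ultimately show ?thesis using D by (simp only: mult_divide_mult_cancel_left_if add_divide_distrib) simp
qed

text \<open>The right-hand sides are the numerators of \<open>outer_bound\<close> and
  \<open>middle_bound\<close>, so \<open>\<rho>\<close> is exactly the gain ratio for both kinds of
  facility. After multiplication by \<open>2 + \<alpha>\<close>, the two sides differ by a multiple
  of \<open>?q\<close>, which vanishes.\<close>

lemma base_loads_scaled:
  fixes \<alpha> x b :: real
  assumes \<alpha>: "0 \<le> \<alpha>" "\<alpha> \<le> 1"
    and x: "2 * (1 - \<alpha>)\<^sup>2 * x\<^sup>2 + (3 + 4 * \<alpha> - \<alpha>\<^sup>2) * x = 1 + \<alpha>"
    and b: "(2 + \<alpha>) * b = \<alpha> + (1 - \<alpha>) * (1/2 + x)"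
    and D: "0 < 2 + 2 * \<alpha> - \<alpha>\<^sup>2"
    and \<rho>: "\<rho> = 1 + 2 * (1 - \<alpha>)\<^sup>2 * x / (2 + 2 * \<alpha> - \<alpha>\<^sup>2)"
  shows "(2 + 2 * \<alpha> - \<alpha>\<^sup>2) * (\<rho> * b) = 1 + \<alpha> * (1 - \<alpha>) * (1/2 - x)"
    and "(2 + 2 * \<alpha> - \<alpha>\<^sup>2) * (\<rho> * (1 - 2 * b)) = \<alpha> + 2 * (1 - \<alpha>) * x"
proof -
  let ?D = "2 + 2 * \<alpha> - \<alpha>\<^sup>2"
  let ?R = "?D + 2 * (1 - \<alpha>)\<^sup>2 * x"
  let ?q = "2 * (1 - \<alpha>)\<^sup>2 * x\<^sup>2 + (3 + 4 * \<alpha> - \<alpha>\<^sup>2) * x - (1 + \<alpha>)"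
  have R: "?D * \<rho> = ?R" using D by (simp add: \<rho> field_simps)
  have q: "?q = 0" using x by simp
  have "(2 + \<alpha>) * (?D * (\<rho> * b)) = ?R * ((2 + \<alpha>) * b)" unfolding R[symmetric] by simp
  also have "\<dots> = (2 + \<alpha>) * (1 + \<alpha> * (1 - \<alpha>) * (1/2 - x)) + (1 - \<alpha>) * ?q"
    unfolding b by (simp add: field_simps power2_eq_square)
  finally show "?D * (\<rho> * b) = 1 + \<alpha> * (1 - \<alpha>) * (1/2 - x)" using q \<alpha> by simp
  have m: "(2 + \<alpha>) * (1 - 2 * b) = 1 - 2 * (1 - \<alpha>) * x"
    using b by (simp add: field_simps)
  have "(2 + \<alpha>) * (?D * (\<rho> * (1 - 2 * b))) = ?R * ((2 + \<alpha>) * (1 - 2 * b))"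
    unfolding R[symmetric] by simp
  also have "\<dots> = (2 + \<alpha>) * (\<alpha> + 2 * (1 - \<alpha>) * x) - 2 * (1 - \<alpha>) * ?q"
    unfolding m by (simp add: field_simps power2_eq_square)
  finally show "?D * (\<rho> * (1 - 2 * b)) = \<alpha> + 2 * (1 - \<alpha>) * x" using q \<alpha> by simp
qed

section \<open>From cuts to client equilibria\<close>

text \<open>For \<open>y \<le> y'\<close> the difference
  \<open>\<bar>y - z\<bar> - \<bar>y' - z\<bar>\<close> is nondecreasing in \<open>z\<close>, which
  is \<open>mono\<close>. Hence equal costs at a cut decide the preference between the two
  neighbours on either side of it; the outer two facilities compare through the middle one.\<close>

lemma split_equilibrium_costs:
  fixes \<alpha> :: real
  assumes \<alpha>: "0 \<le> \<alpha>" "\<alpha> \<le> 1" and split: "split_equilibrium \<alpha> u v w b c"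
    and uvw: "u \<le> v" "v \<le> w"
  shows "z \<le> b \<Longrightarrow> (1 - \<alpha>) * \<bar>u - z\<bar> + \<alpha> * b \<le> (1 - \<alpha>) * \<bar>v - z\<bar> + \<alpha> * (c - b)"
    and "b \<le> z \<Longrightarrow> (1 - \<alpha>) * \<bar>v - z\<bar> + \<alpha> * (c - b) \<le> (1 - \<alpha>) * \<bar>u - z\<bar> + \<alpha> * b"
    and "z \<le> c \<Longrightarrow> (1 - \<alpha>) * \<bar>v - z\<bar> + \<alpha> * (c - b) \<le> (1 - \<alpha>) * \<bar>w - z\<bar> + \<alpha> * (1 - c)"
    and "c \<le> z \<Longrightarrow> (1 - \<alpha>) * \<bar>w - z\<bar> + \<alpha> * (1 - c) \<le> (1 - \<alpha>) * \<bar>v - z\<bar> + \<alpha> * (c - b)"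
proof -
  have e: "(1 - \<alpha>) * \<bar>u - b\<bar> + \<alpha> * b = (1 - \<alpha>) * \<bar>v - b\<bar> + \<alpha> * (c - b)"
     "(1 - \<alpha>) * \<bar>v - c\<bar> + \<alpha> * (c - b) = (1 - \<alpha>) * \<bar>w - c\<bar> + \<alpha> * (1 - c)"
    using split by (auto simp: split_equilibrium_def)
  have mono: "(1 - \<alpha>) * \<bar>y - z\<bar> + (1 - \<alpha>) * \<bar>y' - z'\<bar> \<le> (1 - \<alpha>) * \<bar>y' - z\<bar> + (1 - \<alpha>) * \<bar>y - z'\<bar>"
    if "y \<le> y'" "z \<le> z'" for y y' z z'
  proof -
    have "(1 - \<alpha>) * (\<bar>y - z\<bar> + \<bar>y' - z'\<bar>) \<le> (1 - \<alpha>) * (\<bar>y' - z\<bar> + \<bar>y - z'\<bar>)"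
      using that \<alpha> by (intro mult_left_mono) linarith+
    then show ?thesis by (simp add: distrib_left)
  qed
  show "z \<le> b \<Longrightarrow> (1 - \<alpha>) * \<bar>u - z\<bar> + \<alpha> * b \<le> (1 - \<alpha>) * \<bar>v - z\<bar> + \<alpha> * (c - b)"
    using mono[OF uvw(1), of z b] e(1) by linarith
  show "b \<le> z \<Longrightarrow> (1 - \<alpha>) * \<bar>v - z\<bar> + \<alpha> * (c - b) \<le> (1 - \<alpha>) * \<bar>u - z\<bar> + \<alpha> * b"
    using mono[OF uvw(1), of b z] e(1) by linarith
  show "z \<le> c \<Longrightarrow> (1 - \<alpha>) * \<bar>v - z\<bar> + \<alpha> * (c - b) \<le> (1 - \<alpha>) * \<bar>w - z\<bar> + \<alpha> * (1 - c)"
    using mono[OF uvw(2), of z c] e(2) by linarith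
  show "c \<le> z \<Longrightarrow> (1 - \<alpha>) * \<bar>w - z\<bar> + \<alpha> * (1 - c) \<le> (1 - \<alpha>) * \<bar>v - z\<bar> + \<alpha> * (c - b)"
    using mono[OF uvw(2), of c z] e(2) by linarith
qed

text \<open>The order of the facilities is part of the data, because coincident locations leave it
  undetermined.\<close>

definition in_order_assignment ::
  "real \<Rightarrow> real ^ 'n \<Rightarrow> (real \<Rightarrow> 'n) \<Rightarrow> 'n \<Rightarrow> 'n \<Rightarrow> 'n \<Rightarrow> real \<Rightarrow> real \<Rightarrow> bool" where
  "in_order_assignment \<alpha> t g i j k b c \<longleftrightarrow>
     UNIV = {i, j, k} \<and> distinct [i, j, k] \<and> t $ i \<le> t $ j \<and> t $ j \<le> t $ k \<and>
     split_equilibrium \<alpha> (t $ i) (t $ j) (t $ k) b c \<and>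
     g = (\<lambda>z. if z \<le> b then i else if z \<le> c then j else k)"

lemma in_order_assignment_exists:
  fixes t :: "real ^ 3"
  assumes \<alpha>: "0 \<le> \<alpha>" "\<alpha> \<le> 1" and t: "t \<in> location_vectors"
  shows "\<exists>g i j k b c. in_order_assignment \<alpha> t g i j k b c"
proof -
  have sorted: "\<exists>i j k. UNIV = {i, j, k} \<and> distinct [i, j, k] \<and> t $ i \<le> t $ j \<and> t $ j \<le> t $ k"
  proof -
    have perms: "UNIV = {1, 2, 3::3}" "UNIV = {1, 3, 2::3}" "UNIV = {2, 1, 3::3}"
      "UNIV = {2, 3, 1::3}" "UNIV = {3, 1, 2::3}" "UNIV = {3, 2, 1::3}"
      by (auto simp: UNIV_3)
    have "distinct [1, 2, 3::3]" "distinct [1, 3, 2::3]" "distinct [2, 1, 3::3]"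
      "distinct [2, 3, 1::3]" "distinct [3, 1, 2::3]" "distinct [3, 2, 1::3]"
      by auto
    with perms show ?thesis by (metis linear)
  qed
  then obtain i j k where ijk: "UNIV = {i, j, k}" "distinct [i, j, k]" "t $ i \<le> t $ j" "t $ j \<le> t $ k"
    by blast
  obtain b c where "split_equilibrium \<alpha> (t $ i) (t $ j) (t $ k) b c"
    using split_equilibrium_exists[OF \<alpha> _ ijk(3,4)] t by (auto simp: location_vectors_def)
  then show ?thesis using ijk unfolding in_order_assignment_def by blast
qed

context
  fixes \<alpha> :: real and t :: "real ^ 'n" and f :: "'n client_map" and i j k :: 'n and b c :: real
  assumes assignment: "in_order_assignment \<alpha> t (f t) i j k b c"
begin

lemma in_order_clients:
  "clients_of t f i = {0..b}" "clients_of t f j = {b<..c}" "clients_of t f k = {c<..1}"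
  using assignment
  by (auto simp: in_order_assignment_def clients_of_def split_equilibrium_def split: if_splits)

lemma in_order_loads: "load t f i = b" "load t f j = c - b" "load t f k = 1 - c"
  using assignment
  by (auto simp: load_def in_order_clients in_order_assignment_def split_equilibrium_def)

lemma in_order_intervals: "finite_disjoint_intervals (clients_of t f l)"
proof -
  have "l \<in> {i, j, k}" using assignment by (auto simp: in_order_assignment_def)
  then have "is_interval (clients_of t f l)"
    using in_order_clients by (auto simp: is_interval_cc is_interval_oc)
  then show ?thesis
    unfolding finite_disjoint_intervals_def by (intro exI[of _ "{clients_of t f l}"]) simp
qed

lemma in_order_client_equilibrium:
  assumes \<alpha>: "0 \<le> \<alpha>" "\<alpha> \<le> 1"
  shows "client_equilibrium \<alpha> t f"
  unfolding client_equilibrium_def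
proof (intro ballI allI)
  fix z :: real and l
  have *: "t $ i \<le> t $ j" "t $ j \<le> t $ k" "split_equilibrium \<alpha> (t $ i) (t $ j) (t $ k) b c"
    and ft: "f t z = (if z \<le> b then i else if z \<le> c then j else k)"
    using assignment by (auto simp: in_order_assignment_def)
  have "b \<le> c" using *(3) by (auto simp: split_equilibrium_def)
  note costs = split_equilibrium_costs[OF \<alpha> *(3) *(1,2), where z = z]
  have "l = i \<or> l = j \<or> l = k" using assignment by (auto simp: in_order_assignment_def)
  then show "client_cost \<alpha> t f z \<le> cost_at \<alpha> t f z l"
    unfolding client_cost_def cost_at_def ft
    using costs \<open>b \<le> c\<close> by (auto simp: in_order_loads)
qed

end

text \<open>The strict inequality fixes the order of the two other facilities, so only the rank of
  \<open>d\<close> remains open, even if \<open>d\<close> coincides with one of them.\<close>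

lemma in_order_load_of_deviator:
  assumes assignment: "in_order_assignment \<alpha> t (f t) i j k b c"
    and d: "distinct [d, e, g]" and less: "t $ e < t $ g"
  shows "(\<exists>b c. split_equilibrium \<alpha> (t $ d) (t $ e) (t $ g) b c \<and> t $ d \<le> t $ e \<and> load t f d = b) \<or>
    (\<exists>b c. split_equilibrium \<alpha> (t $ e) (t $ d) (t $ g) b c \<and> t $ e \<le> t $ d \<and> t $ d \<le> t $ g \<and>
       load t f d = c - b) \<or>
    (\<exists>b c. split_equilibrium \<alpha> (t $ e) (t $ g) (t $ d) b c \<and> t $ g \<le> t $ d \<and> load t f d = 1 - c)"
proof -
  have *: "d \<in> {i, j, k}" "e \<in> {i, j, k}" "g \<in> {i, j, k}" "t $ i \<le> t $ j" "t $ j \<le> t $ k"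
    "split_equilibrium \<alpha> (t $ i) (t $ j) (t $ k) b c"
    using assignment by (auto simp: in_order_assignment_def)
  consider "d = i" "e = j" "g = k" | "d = j" "e = i" "g = k" | "d = k" "e = i" "g = j"
    using * d less by auto
  then show ?thesis
    using * in_order_loads[where f = f and t = t, OF assignment] by cases blast+
qed

section \<open>Assembling the approximate equilibrium\<close>

theorem theorem1:
  fixes \<alpha> :: real
  assumes "\<alpha> \<in> {0..1}"
  shows "\<exists>(s :: real ^ 3) (f :: 3 client_map).
           approx_SPE \<alpha>
             ((1 - \<alpha>\<^sup>2 + sqrt (17 + \<alpha> * (16 + 2 * \<alpha> + \<alpha> ^ 3))) / (4 - 2 * (\<alpha> - 2) * \<alpha>)) s f"
proof -
  have \<alpha>: "0 \<le> \<alpha>" "\<alpha> \<le> 1" using assms by auto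
  define D where "D = 2 + 2 * \<alpha> - \<alpha>\<^sup>2"
  have D: "0 < D" unfolding D_def using denominator_pos \<alpha> by blast
  obtain x where x: "1 \<le> (4 - \<alpha>) * x" "x \<le> 1/3"
    and quadratic: "2 * (1 - \<alpha>)\<^sup>2 * x\<^sup>2 + (3 + 4 * \<alpha> - \<alpha>\<^sup>2) * x = 1 + \<alpha>"
    using optimal_location_exists[OF \<alpha>] by blast
  have "0 < (4 - \<alpha>) * x" using x(1) by linarith
  then have x0: "0 < x" using \<alpha> by (simp add: zero_less_mult_iff)
  define \<rho> where
    "\<rho> = (1 - \<alpha>\<^sup>2 + sqrt (17 + \<alpha> * (16 + 2 * \<alpha> + \<alpha> ^ 3))) / (4 - 2 * (\<alpha> - 2) * \<alpha>)"
  have \<rho>: "\<rho> = 1 + 2 * (1 - \<alpha>)\<^sup>2 * x / D"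
    unfolding \<rho>_def D_def using ratio_eq[OF \<alpha> _ quadratic] x0 D by (simp add: D_def)
  then have "1 \<le> \<rho>" using D x0 by simp

  define s :: "real ^ 3" where "s = vector [x, 1/2, 1 - x]"
  have s [simp]: "s $ 1 = x" "s $ 2 = 1/2" "s $ 3 = 1 - x" by (simp_all add: s_def)
  \<comment> \<open>The cuts are chosen separately for each location vector, without any coherence
    between them. This suffices because the deviation bounds hold for all equilibrium cuts.\<close>
  define f :: "3 client_map" where
    "f t = (SOME g. \<exists>i j k b c. in_order_assignment \<alpha> t g i j k b c)" for t
  have f: "\<exists>i j k b c. in_order_assignment \<alpha> t (f t) i j k b c" if "t \<in> location_vectors" for t
    unfolding f_def using someI_ex[OF in_order_assignment_exists[OF \<alpha> that]] .
  have load: "(\<exists>b c. split_equilibrium \<alpha> (t $ d) (t $ e) (t $ g) b c \<and> t $ d \<le> t $ e \<and> load t f d = b) \<or>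
      (\<exists>b c. split_equilibrium \<alpha> (t $ e) (t $ d) (t $ g) b c \<and> t $ e \<le> t $ d \<and> t $ d \<le> t $ g \<and>
         load t f d = c - b) \<or>
      (\<exists>b c. split_equilibrium \<alpha> (t $ e) (t $ g) (t $ d) b c \<and> t $ g \<le> t $ d \<and> load t f d = 1 - c)"
    if "t \<in> location_vectors" "distinct [d, e, g]" "t $ e < t $ g" for t d e g
    using f[OF that(1)] in_order_load_of_deviator[of \<alpha> t f _ _ _ _ _ d e g] that(2,3) by blast

  have s_loc: "s \<in> location_vectors"
    using x0 x by (auto simp: location_vectors_def forall_3)
  define B where "B = (\<alpha> + (1 - \<alpha>) * (1/2 + x)) / (2 + \<alpha>)"
  have base: "c = 1 - b \<and> b = B" if "split_equilibrium \<alpha> x (1/2) (1 - x) b c" for b c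
    using split_equilibrium_base[OF \<alpha> that] x0 x(2) \<alpha> by (simp add: B_def field_simps)
  have s_load: "load s f 1 = B" "load s f 2 = 1 - 2 * B" "load s f 3 = B"
    using load[OF s_loc, of 1 2 3] load[OF s_loc, of 2 1 3] load[OF s_loc, of 3 1 2] x0 x(2)
    by (auto dest!: base)
  have B: "(2 + \<alpha>) * B = \<alpha> + (1 - \<alpha>) * (1/2 + x)" using \<alpha> by (simp add: B_def)
  have outer: "outer_bound \<alpha> x = \<rho> * B"
    using base_loads_scaled(1)[OF \<alpha> quadratic B, of \<rho>] D \<rho> unfolding outer_bound_def D_def
    by (metis less_irrefl nonzero_mult_div_cancel_left)
  have middle: "middle_bound \<alpha> x = \<rho> * (1 - 2 * B)"
    using base_loads_scaled(2)[OF \<alpha> quadratic B, of \<rho>] D \<rho> unfolding middle_bound_def D_def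
    by (metis less_irrefl nonzero_mult_div_cancel_left)
  have middle_load: "(\<alpha> + (1 - \<alpha>) * (1 - 2 * x)) / (2 + \<alpha>) = 1 - 2 * B"
    using \<alpha> by (simp add: B_def field_simps)
  have "(1 - \<alpha>) * (2 * x) \<le> 1 * 1" using \<alpha> x x0 by (intro mult_mono) auto
  then have "0 \<le> 1 - 2 * B" unfolding middle_load[symmetric] using \<alpha> by (simp add: algebra_simps)
  then have "1 - 2 * B \<le> \<rho> * (1 - 2 * B)" using \<open>1 \<le> \<rho>\<close> mult_right_mono by fastforce
  \<comment> \<open>Staying between the outer facilities yields at most the old load or
    \<open>middle_bound\<close>; since \<open>1 \<le> \<rho>\<close>, the latter dominates.\<close>
  then have middle_max:
    "max (middle_bound \<alpha> x) ((\<alpha> + (1 - \<alpha>) * (1 - 2 * x)) / (2 + \<alpha>)) = \<rho> * (1 - 2 * B)"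
    unfolding middle middle_load by simp
  note bounds = split_equilibrium_deviation_bounds[OF \<alpha> x, unfolded middle_max, unfolded outer middle]

  have "load (relocate s d y) f d \<le> \<rho> * load s f d" if y: "y \<in> {0..1}" for d y
  proof -
    let ?t = "relocate s d y"
    have t: "?t \<in> location_vectors" using s_loc y by (auto simp: location_vectors_def relocate_def)
    have t_nth: "?t $ l = (if l = d then y else s $ l)" for l by (simp add: relocate_def)
    consider "d = 1" | "d = 2" | "d = 3" using exhaust_3 by blast
    then show ?thesis
    proof cases
      case 1
      have pos: "?t $ 1 = y" "?t $ 2 = 1/2" "?t $ 3 = 1 - x" using t_nth 1 by auto
      show ?thesis
        using load[OF t, of 1 2 3, unfolded pos] bounds(1,2,3) x(2) unfolding 1 s_load by auto
    next
      case 2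
      have pos: "?t $ 2 = y" "?t $ 1 = x" "?t $ 3 = 1 - x" using t_nth 2 by auto
      \<comment> \<open>Reflection exchanges the locations \<open>x\<close> and
        \<open>1 - x\<close>, so moving to the far right mirrors moving to the far left.\<close>
      have "1 - c \<le> \<rho> * (1 - 2 * B)"
        if "split_equilibrium \<alpha> x (1 - x) y b c" "1 - x \<le> y" for b c
        using bounds(4)[of "1 - y" "1 - c" "1 - b"] split_equilibrium_reflect[OF that(1)] that(2)
        by simp
      then show ?thesis
        using load[OF t, of 2 1 3, unfolded pos] bounds(4,5) x(2) unfolding 2 s_load by auto
    next
      case 3
      have pos: "?t $ 3 = y" "?t $ 1 = x" "?t $ 2 = 1/2" using t_nth 3 by auto
      \<comment> \<open>Reflection turns the deviations of the right outer facility into those of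
        the left one, with the ranks reversed.\<close>
      have "b \<le> \<rho> * B" if "split_equilibrium \<alpha> y x (1/2) b c" "y \<le> x" for b c
        using bounds(3)[of "1 - y" "1 - c" "1 - b"] split_equilibrium_reflect[OF that(1)] that(2)
        by simp
      moreover have "c - b \<le> \<rho> * B"
        if "split_equilibrium \<alpha> x y (1/2) b c" "x \<le> y" "y \<le> 1/2" for b c
        using bounds(2)[of "1 - y" "1 - c" "1 - b"] split_equilibrium_reflect[OF that(1)] that(2,3)
        by simp
      moreover have "1 - c \<le> \<rho> * B" if "split_equilibrium \<alpha> x (1/2) y b c" "1/2 \<le> y" for b c
        using bounds(1)[of "1 - y" "1 - c" "1 - b"] split_equilibrium_reflect[OF that(1)] that(2)
        by simp
      ultimately show ?thesis
        using load[OF t, of 3 1 2, unfolded pos] x(2) unfolding 3 s_load by auto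
    qed
  qed
  moreover have "measurable_client_map f"
    unfolding measurable_client_map_def using f in_order_intervals by blast
  moreover have "client_equilibrium \<alpha> t f" if "t \<in> location_vectors" for t
    using f[OF that] in_order_client_equilibrium \<alpha> by blast
  ultimately have "approx_SPE \<alpha> \<rho> s f"
    unfolding approx_SPE_def utility_def using s_loc by blast
  then show ?thesis unfolding \<rho>_def by blast
qed

end
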